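(* Let $G=(V,E)$ be a finite undirected graph with $n$ vertices and vertex weights $w(v)=\log_2|D(v)|$, where $D(v)$ is a finite set with at least two elements for each $v\in V$. Let $m$ and $\alpha\ge1$ be real numbers and let $W\subseteq V$ satisfy $w(W)<(\alpha+1)m$. Then the recursive algorithm $\mathrm{W\text{-}Triangulate}(G,W,m)$ (defined in the context, with parameter $\alpha$) either triangulates $G$, by adding edges, in such a way that the vertices of $W$ form a clique and the weight of a heaviest clique of the triangulated graph is $<(2\alpha+1)m$, or it correctly outputs that the weighted cliquewidth of $G$ is larger than $m$.
   Context: For $S\subseteq V$, $w(S)=\sum_{v\in S}w(v)$. A triangulation of $G$ is a chordal graph on the same vertex set obtained from $G$ by adding edges. The weighted cliquewidth of $G$ is the minimum, over all triangulations $H$ of $G$, of the maximum weight of a clique of $H$ (equivalently, the weight of the heaviest clique in a junction tree of $G$ in which this weight is minimized). $G[S]$ denotes the subgraph induced by $S$. A decomposition of $G=(V,E)$ is a partition $(X,A,B,C)$ of $V$ with $A$ and $B$ non-empty ($X$ and $C$ may be empty) such that there are no edges of $G$ between any two of the sets $A,B,C$. If $w(V)\ge(2\alpha+1)m$, a weighted $W$-decomposition with respect to $(m,\alpha)$ is a decomposition $(X,A,B,C)$ of $G$ such that $w(W)<(\alpha+1)m$, $w(X)\le\alpha m$, $w((W\cap A)\cup X)<(\alpha+1)m$, $w((W\cap B)\cup X)<(\alpha+1)m$ and $w((W\cap C)\cup X)<(\alpha+1)m$. Algorithm $\mathrm{W\text{-}Triangulate}(G,W,m)$ with $G=(V,E)$: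 If $w(V)<(2\alpha+1)m$, make $W$ a clique and triangulate the resulting graph by the minimum weight heuristic: repeatedly select a vertex $v$ of the current graph for which $\{v\}\cup N(v)$ has minimum weight ($N(v)$ being its neighbors in the current graph), make $N(v)$ a clique, and remove $v$ from the current graph. Otherwise, find a weighted $W$-decomposition $(X,A,B,C)$ of $G$ with respect to $(m,\alpha)$; if none is found (the search finds one whenever one exists), return "weighted cliquewidth $>m$". Otherwise call $\mathrm{W\text{-}Triangulate}(G[A\cup X],(W\cap A)\cup X,m)$, $\mathrm{W\text{-}Triangulate}(G[B\cup X],(W\cap B)\cup X,m)$ and $\mathrm{W\text{-}Triangulate}(G[C\cup X],(W\cap C)\cup X,m)$, and then make $W\cup X$ a clique. The triangulated graph is $G$ together with all edges added in this call and in all recursive calls. If any recursive call returns "weighted cliquewidth $>m$", so does the whole algorithm. *)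

theory Defs
  imports Complex_Main "HOL-Library.Ramsey"
begin

text \<open>
  A finite simple graph is a finite vertex set \<open>V\<close> together with an edge set
  \<open>E \<subseteq> [V]\<^bsup>2\<^esup>\<close>, where \<open>[V]\<^bsup>2\<^esup>\<close> is the set of
  two-element subsets of \<open>V\<close> from \<^theory>\<open>HOL-Library.Ramsey\<close>.
  Consequently, making \<open>S\<close> a clique means adding the edges \<open>[S]\<^bsup>2\<^esup>\<close>.
\<close>

definition is_clique :: "'a set set \<Rightarrow> 'a set \<Rightarrow> bool" where
  "is_clique E K \<longleftrightarrow> [K]\<^bsup>2\<^esup> \<subseteq> E"

definition neighbors :: "'a set set \<Rightarrow> 'a \<Rightarrow> 'a set" where
  "neighbors E v = {u. {u, v} \<in> E}"

definition induced_edges :: "'a set set \<Rightarrow> 'a set \<Rightarrow> 'a set set" where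
  "induced_edges E S = {e \<in> E. e \<subseteq> S}"

definition no_edges_between :: "'a set set \<Rightarrow> 'a set \<Rightarrow> 'a set \<Rightarrow> bool" where
  "no_edges_between E S T \<longleftrightarrow> (\<forall>s\<in>S. \<forall>t\<in>T. {s, t} \<notin> E)"

text \<open>The edges of the closed walk through the vertices of a list in the given order.\<close>

definition cycle_edges :: "'a list \<Rightarrow> 'a set set" where
  "cycle_edges vs = {{vs ! i, vs ! (Suc i mod length vs)} | i. i < length vs}"

definition chordal :: "'a set set \<Rightarrow> bool" where
  "chordal E \<longleftrightarrow>
    (\<forall>vs. distinct vs \<and> length vs \<ge> 4 \<and> cycle_edges vs \<subseteq> E \<longrightarrow>
      (\<exists>e\<in>E. e \<subseteq> set vs \<and> e \<notin> cycle_edges vs))"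

definition triangulation :: "'a set \<Rightarrow> 'a set set \<Rightarrow> 'a set set \<Rightarrow> bool" where
  "triangulation V E H \<longleftrightarrow> E \<subseteq> H \<and> H \<subseteq> [V]\<^bsup>2\<^esup> \<and> chordal H"

text \<open>
  The weight \<open>w(S)\<close> of a vertex set is \<^term>\<open>sum w S\<close>. For finite \<open>V\<close>, \<open>Max\<close> and
  \<open>Min\<close> below range over finite non-empty sets: the empty set is a clique, and the
  complete graph is a triangulation.
\<close>

definition max_clique_weight :: "('a \<Rightarrow> real) \<Rightarrow> 'a set \<Rightarrow> 'a set set \<Rightarrow> real" where
  "max_clique_weight w V H = Max {sum w K | K. K \<subseteq> V \<and> is_clique H K}"

definition weighted_cliquewidth :: "('a \<Rightarrow> real) \<Rightarrow> 'a set \<Rightarrow> 'a set set \<Rightarrow> real" where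
  "weighted_cliquewidth w V E = Min {max_clique_weight w V H | H. triangulation V E H}"

definition decomposition ::
    "'a set \<Rightarrow> 'a set set \<Rightarrow> 'a set \<Rightarrow> 'a set \<Rightarrow> 'a set \<Rightarrow> 'a set \<Rightarrow> bool" where
  "decomposition V E X A B C \<longleftrightarrow>
    X \<union> A \<union> B \<union> C = V \<and>
    X \<inter> A = {} \<and> X \<inter> B = {} \<and> X \<inter> C = {} \<and> A \<inter> B = {} \<and> A \<inter> C = {} \<and> B \<inter> C = {} \<and>
    A \<noteq> {} \<and> B \<noteq> {} \<and>
    no_edges_between E A B \<and> no_edges_between E A C \<and> no_edges_between E B C"

definition weighted_decomposition ::
    "('a \<Rightarrow> real) \<Rightarrow> real \<Rightarrow> real \<Rightarrow> 'a set \<Rightarrow> 'a set set \<Rightarrow> 'a set \<Rightarrow>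
     'a set \<Rightarrow> 'a set \<Rightarrow> 'a set \<Rightarrow> 'a set \<Rightarrow> bool" where
  "weighted_decomposition w m \<alpha> V E W X A B C \<longleftrightarrow>
    sum w V \<ge> (2 * \<alpha> + 1) * m \<and>
    decomposition V E X A B C \<and>
    sum w W < (\<alpha> + 1) * m \<and>
    sum w X \<le> \<alpha> * m \<and>
    sum w ((W \<inter> A) \<union> X) < (\<alpha> + 1) * m \<and>
    sum w ((W \<inter> B) \<union> X) < (\<alpha> + 1) * m \<and>
    sum w ((W \<inter> C) \<union> X) < (\<alpha> + 1) * m"

text \<open>
  \<open>min_weight_fill w V E F\<close>: some run of the minimum weight heuristic on the graph
  \<open>(V, E)\<close>, with ties between vertices broken arbitrarily, makes exactly the pairs in
  \<open>F\<close> adjacent (some of them may already be edges).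
\<close>

inductive min_weight_fill ::
    "('a \<Rightarrow> real) \<Rightarrow> 'a set \<Rightarrow> 'a set set \<Rightarrow> 'a set set \<Rightarrow> bool" for w where
  empty: "min_weight_fill w {} E {}"
| eliminate:
    "min_weight_fill w V E ([neighbors E v]\<^bsup>2\<^esup> \<union> F)"
    if "v \<in> V"
      and "\<forall>u\<in>V. sum w ({v} \<union> neighbors E v) \<le> sum w ({u} \<union> neighbors E u)"
      and "min_weight_fill w (V - {v}) (induced_edges (E \<union> [neighbors E v]\<^bsup>2\<^esup>) (V - {v})) F"

text \<open>
  An outcome is either the set of all edges added to the input graph, or the
  answer that the weighted cliquewidth exceeds \<open>m\<close>.
\<close>

datatype 'a outcome = Added "'a set set" | Width_Exceeded

fun combine :: "'a set set \<Rightarrow> 'a outcome \<Rightarrow> 'a outcome \<Rightarrow> 'a outcome \<Rightarrow> 'a outcome" where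
  "combine F (Added F1) (Added F2) (Added F3) = Added (F1 \<union> F2 \<union> F3 \<union> F)"
| "combine F _ _ _ = Width_Exceeded"

text \<open>
  \<open>W_Triangulate w m \<alpha> V E W r\<close>: some run of the algorithm on input \<open>((V, E), W, m)\<close>
  terminates with outcome \<open>r\<close>. The relation leaves open which decomposition the search
  returns and how the heuristic breaks ties, and so covers every implementation.
\<close>

inductive W_Triangulate ::
    "('a \<Rightarrow> real) \<Rightarrow> real \<Rightarrow> real \<Rightarrow> 'a set \<Rightarrow> 'a set set \<Rightarrow> 'a set \<Rightarrow> 'a outcome \<Rightarrow> bool"
    for w m \<alpha> where
  small:
    "W_Triangulate w m \<alpha> V E W (Added ([W]\<^bsup>2\<^esup> \<union> F))"
    if "sum w V < (2 * \<alpha> + 1) * m"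
      and "min_weight_fill w V (E \<union> [W]\<^bsup>2\<^esup>) F"
| not_found:
    "W_Triangulate w m \<alpha> V E W Width_Exceeded"
    if "sum w V \<ge> (2 * \<alpha> + 1) * m"
      and "\<nexists>X A B C. weighted_decomposition w m \<alpha> V E W X A B C"
| split:
    "W_Triangulate w m \<alpha> V E W (combine ([W \<union> X]\<^bsup>2\<^esup>) rA rB rC)"
    if "sum w V \<ge> (2 * \<alpha> + 1) * m"
      and "weighted_decomposition w m \<alpha> V E W X A B C"
      and "W_Triangulate w m \<alpha> (A \<union> X) (induced_edges E (A \<union> X)) ((W \<inter> A) \<union> X) rA"
      and "W_Triangulate w m \<alpha> (B \<union> X) (induced_edges E (B \<union> X)) ((W \<inter> B) \<union> X) rB"
      and "W_Triangulate w m \<alpha> (C \<union> X) (induced_edges E (C \<union> X)) ((W \<inter> C) \<union> X) rC"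

text \<open>
  \<open>recursive_call w m \<alpha> i j\<close>: some run on input \<open>j\<close> may directly call the algorithm on
  input \<open>i\<close>. Accessibility of an input in this relation says that no run on it, whatever
  choices are made, has an infinite chain of nested calls; the relation
  \<^const>\<open>W_Triangulate\<close>, which only describes terminating runs, cannot express this.
\<close>

inductive recursive_call ::
    "('a \<Rightarrow> real) \<Rightarrow> real \<Rightarrow> real \<Rightarrow>
     'a set \<times> 'a set set \<times> 'a set \<Rightarrow> 'a set \<times> 'a set set \<times> 'a set \<Rightarrow> bool"
    for w m \<alpha> where
  "recursive_call w m \<alpha> (P \<union> X, induced_edges E (P \<union> X), (W \<inter> P) \<union> X) (V, E, W)"
  if "sum w V \<ge> (2 * \<alpha> + 1) * m"
    and "weighted_decomposition w m \<alpha> V E W X A B C"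
    and "P \<in> {A, B, C}"

end

theory Submission
  imports Defs
begin

text \<open>
  Chordal graphs are those in which every non-empty finite vertex set \<open>U\<close> contains a vertex
  whose neighbours in \<open>U\<close> form a clique. In this form chordality is evident for the result of
  an elimination, and it is preserved by gluing two graphs along a common clique; the triangulation
  produced by a split is such a gluing of the three recursive results with the clique on
  \<open>W \<union> X\<close>, so every clique lies in one of the four pieces, and
  \<open>w(W \<union> X) < (\<alpha> + 1) m + \<alpha> m\<close>.

  If the search fails although some triangulation \<open>H\<close> has only cliques of weight at most \<open>m\<close>,
  consider a largest clique \<open>X\<close> of \<open>H\<close> all of whose remaining components carry at most half
  of the weight of \<open>W\<close>. Several components can be packed into three bins of at most half the
  weight each. If there is one component \<open>Q\<close>, some vertex of \<open>X\<close> has no neighbour in \<open>Q\<close>, since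
  otherwise a vertex of \<open>Q\<close> adjacent to all of \<open>X\<close> would enlarge \<open>X\<close>, and the neighbours of
  \<open>Q\<close> in \<open>X\<close> separate. Because \<open>\<alpha> \<ge> 1\<close>, half of \<open>w(W)\<close> plus \<open>m\<close> is below
  \<open>(\<alpha> + 1) m\<close>. Cliquewidth bounds pass to induced subgraphs, so a failure anywhere in the
  recursion is correct for the whole graph.
\<close>

section \<open>Cliques and neighbourhoods in graphs given by two-element sets\<close>

lemma doubleton_mem_nsets: "{x, y} \<in> [S]\<^bsup>2\<^esup> \<longleftrightarrow> x \<in> S \<and> y \<in> S \<and> x \<noteq> y"
  by (auto simp: nsets_def card_insert_if)

lemma is_clique_iff: "is_clique E K \<longleftrightarrow> (\<forall>x\<in>K. \<forall>y\<in>K. x \<noteq> y \<longrightarrow> {x, y} \<in> E)"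
proof
  assume "is_clique E K"
  then show "\<forall>x\<in>K. \<forall>y\<in>K. x \<noteq> y \<longrightarrow> {x, y} \<in> E"
    unfolding is_clique_def by (meson doubleton_mem_nsets subsetD)
next
  assume "\<forall>x\<in>K. \<forall>y\<in>K. x \<noteq> y \<longrightarrow> {x, y} \<in> E"
  then show "is_clique E K"
    unfolding is_clique_def nsets_def by (auto simp: card_2_iff)
qed

lemma is_cliqueD: "is_clique E K \<Longrightarrow> x \<in> K \<Longrightarrow> y \<in> K \<Longrightarrow> x \<noteq> y \<Longrightarrow> {x, y} \<in> E"
  by (simp add: is_clique_iff)

lemma is_clique_subset: "is_clique E K \<Longrightarrow> L \<subseteq> K \<Longrightarrow> is_clique E L"
  by (auto simp: is_clique_iff)

lemma is_clique_mono: "is_clique E K \<Longrightarrow> E \<subseteq> F \<Longrightarrow> is_clique F K"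
  by (auto simp: is_clique_iff)

lemma mem_neighbors [simp]: "u \<in> neighbors E v \<longleftrightarrow> {u, v} \<in> E"
  by (simp add: neighbors_def)

lemma no_edges_between_commute: "no_edges_between E S T \<longleftrightarrow> no_edges_between E T S"
  unfolding no_edges_between_def by (metis insert_commute)

section \<open>Chordal graphs and simplicial vertices\<close>

definition simplicial :: "'a set set \<Rightarrow> 'a set \<Rightarrow> 'a \<Rightarrow> bool" where
  "simplicial E U v \<longleftrightarrow> v \<in> U \<and> is_clique E (neighbors E v \<inter> U)"

text \<open>\<open>U\<close> ranges over all finite sets, not only over subsets of a vertex set: a
  point of \<open>U\<close> without neighbours in \<open>U\<close> is trivially simplicial, so no
  mention of \<open>V\<close> is needed.\<close>

definition hereditarily_simplicial :: "'a set set \<Rightarrow> bool" where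
  "hereditarily_simplicial E \<longleftrightarrow> (\<forall>U. finite U \<and> U \<noteq> {} \<longrightarrow> (\<exists>v. simplicial E U v))"

text \<open>A simplicial vertex of the vertex set of a cycle has adjacent neighbours on the cycle,
  and from length 4 on the edge joining them is a chord.\<close>

lemma chordal_if_hereditarily_simplicial:
  assumes "hereditarily_simplicial E"
  shows "chordal E"
  unfolding chordal_def
proof (intro allI impI, elim conjE)
  fix vs :: "'a list"
  assume d: "distinct vs" and l: "length vs \<ge> 4" and c: "cycle_edges vs \<subseteq> E"
  let ?n = "length vs"
  have nxt: "{vs ! i, vs ! (Suc i mod ?n)} \<in> E" if "i < ?n" for i
    using c that by (auto simp: cycle_edges_def)
  obtain v where v: "simplicial E (set vs) v"
    using assms l unfolding hereditarily_simplicial_def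
    by (metis List.finite_set list.size(3) not_numeral_le_zero set_empty)
  then obtain i where i: "i < ?n" "v = vs ! i"
    by (auto simp: simplicial_def in_set_conv_nth)
  \<comment> \<open>\<open>j\<close> and \<open>k\<close> are the cyclic predecessor and successor
    of \<open>i\<close>; written by cases, the wrap-around needs no \<open>mod\<close>.\<close>
  define j where "j = (if i = 0 then ?n - 1 else i - 1)"
  define k where "k = (if Suc i = ?n then 0 else Suc i)"
  have j: "j < ?n" "Suc j mod ?n = i" using i l by (auto simp: j_def)
  have k: "k < ?n" "Suc i mod ?n = k" using i l by (auto simp: k_def)
  have jk: "j \<noteq> k" using i l by (auto simp: j_def k_def split: if_splits)
  have "{vs ! j, v} \<in> E" using nxt[OF j(1)] i j by simp
  moreover have "{vs ! k, v} \<in> E" using nxt[OF i(1)] i k by (simp add: insert_commute)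
  ultimately have "{vs ! j, vs ! k} \<in> E"
    using v j k jk d by (auto simp: simplicial_def is_clique_iff nth_eq_iff_index_eq)
  moreover have "{vs ! j, vs ! k} \<notin> cycle_edges vs"
  proof
    assume "{vs ! j, vs ! k} \<in> cycle_edges vs"
    then obtain l where l': "l < ?n" "{vs ! j, vs ! k} = {vs ! l, vs ! (Suc l mod ?n)}"
      by (auto simp: cycle_edges_def)
    have "Suc l mod ?n < ?n" using l by (intro mod_less_divisor) auto
    with l' d j k have "(j = l \<and> k = Suc l mod ?n) \<or> (k = l \<and> j = Suc l mod ?n)"
      by (auto simp: doubleton_eq_iff nth_eq_iff_index_eq)
    moreover have "Suc l mod ?n = (if Suc l = ?n then 0 else Suc l)" using l' by auto
    \<comment> \<open>Positions two steps apart are never consecutive on a cycle of length at least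
      4; on a triangle they would be.\<close>
    ultimately show False using i l by (auto simp: j_def k_def split: if_splits)
  qed
  ultimately show "\<exists>e\<in>E. e \<subseteq> set vs \<and> e \<notin> cycle_edges vs"
    using j k by (intro bexI[of _ "{vs ! j, vs ! k}"]) auto
qed

section \<open>Connected sets, components and their attachments\<close>

definition connected_set :: "'a set set \<Rightarrow> 'a set \<Rightarrow> bool" where
  "connected_set E Q \<longleftrightarrow>
    Q \<noteq> {} \<and> (\<forall>P\<subseteq>Q. P \<noteq> {} \<and> no_edges_between E P (Q - P) \<longrightarrow> P = Q)"

definition component :: "'a set set \<Rightarrow> 'a set \<Rightarrow> 'a set \<Rightarrow> bool" where
  "component E T Q \<longleftrightarrow> Q \<subseteq> T \<and> connected_set E Q \<and> no_edges_between E Q (T - Q)"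

lemma connected_setD:
  "connected_set E Q \<Longrightarrow> P \<subseteq> Q \<Longrightarrow> P \<noteq> {} \<Longrightarrow> no_edges_between E P (Q - P) \<Longrightarrow> P = Q"
  unfolding connected_set_def by meson

text \<open>A smallest non-empty part of \<open>T\<close> without edges to the rest of
  \<open>T\<close> is connected: a piece cut off inside it would be cut off inside \<open>T\<close>
  as well, and be smaller.\<close>

lemma component_exists:
  assumes "finite T" "T \<noteq> {}"
  obtains Q where "component E T Q"
proof -
  let ?P = "\<lambda>Q. Q \<subseteq> T \<and> Q \<noteq> {} \<and> no_edges_between E Q (T - Q)"
  have "?P T" using assms by (auto simp: no_edges_between_def)
  then obtain Q where Q: "?P Q" and min: "\<And>R. ?P R \<Longrightarrow> card Q \<le> card R"
    using exists_least_iff[of "\<lambda>n. \<exists>Q. ?P Q \<and> card Q = n"] by (metis (mono_tags, lifting) not_less)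
  have "connected_set E Q"
    unfolding connected_set_def
  proof (intro conjI allI impI, use Q in blast, elim conjE)
    fix P assume P: "P \<subseteq> Q" "P \<noteq> {}" "no_edges_between E P (Q - P)"
    then have "?P P" using Q unfolding no_edges_between_def by blast
    then have "card Q \<le> card P" by (rule min)
    then show "P = Q" using P Q assms by (meson card_seteq finite_subset)
  qed
  with Q that show thesis by (auto simp: component_def)
qed

text \<open>Passes from the cut form of connectivity to walks: the points reachable from
  \<open>x\<close> inside \<open>Q\<close> have no edge to the rest of \<open>Q\<close>, so they
  exhaust it.\<close>

lemma connected_set_rtrancl:
  assumes "connected_set E Q" "x \<in> Q" "y \<in> Q"
  shows "(x, y) \<in> {(a, b). a \<in> Q \<and> b \<in> Q \<and> {a, b} \<in> E}\<^sup>*"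
proof -
  let ?R = "{(a, b). a \<in> Q \<and> b \<in> Q \<and> {a, b} \<in> E}"
  let ?P = "{y \<in> Q. (x, y) \<in> ?R\<^sup>*}"
  have "no_edges_between E ?P (Q - ?P)"
    by (auto simp: no_edges_between_def intro: rtrancl_into_rtrancl)
  moreover have "x \<in> ?P" using assms by auto
  ultimately have "?P = Q" by (intro connected_setD[OF assms(1)]) blast+
  with assms show ?thesis by auto
qed

text \<open>A shortest path through \<open>Q\<close> between two non-adjacent neighbours of \<open>v\<close> closes up
  to a chordless cycle through \<open>v\<close>.\<close>

lemma chordal_attachment_clique:
  assumes "chordal E" and loopless: "\<forall>e\<in>E. card e = 2"
    and Q: "connected_set E Q" and v: "v \<notin> Q" "no_edges_between E {v} Q"
  shows "is_clique E {s. {s, v} \<in> E \<and> (\<exists>q\<in>Q. {s, q} \<in> E)}"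
  unfolding is_clique_iff
proof (intro ballI impI, rule ccontr)
  fix s t
  assume "s \<in> {s. {s, v} \<in> E \<and> (\<exists>q\<in>Q. {s, q} \<in> E)}" "t \<in> {s. {s, v} \<in> E \<and> (\<exists>q\<in>Q. {s, q} \<in> E)}"
  then obtain p q where s: "{s, v} \<in> E" "p \<in> Q" "{s, p} \<in> E" and t: "{t, v} \<in> E" "q \<in> Q" "{t, q} \<in> E"
    by auto
  assume st: "s \<noteq> t" "{s, t} \<notin> E"
  have vQ: "{v, x} \<notin> E" if "x \<in> Q" for x using v that by (auto simp: no_edges_between_def)
  have vs: "v \<noteq> s" "v \<noteq> t" using loopless s(1) t(1) by (auto simp: card_insert_if)
  \<comment> \<open>Walks in \<open>R\<close> stay inside \<open>Q\<close> together with the ends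
    \<open>s\<close> and \<open>t\<close>; one of least length \<open>n\<close> turns out to be an
    induced path.\<close>
  define R where "R = {(a, b). a \<in> insert s (insert t Q) \<and> b \<in> insert s (insert t Q) \<and> {a, b} \<in> E}"
  have "(p, q) \<in> {(a, b). a \<in> Q \<and> b \<in> Q \<and> {a, b} \<in> E}\<^sup>*"
    using connected_set_rtrancl Q s t by fast
  then have "(p, q) \<in> R\<^sup>*" by (rule rtrancl_mono[THEN subsetD, rotated]) (auto simp: R_def)
  moreover have "(s, p) \<in> R" "(q, t) \<in> R" using s t by (auto simp: R_def insert_commute)
  ultimately have "(s, t) \<in> R\<^sup>*"
    by (meson converse_rtrancl_into_rtrancl rtrancl_into_rtrancl)
  then obtain n where n: "(s, t) \<in> R ^^ n" and least: "\<And>k. (s, t) \<in> R ^^ k \<Longrightarrow> n \<le> k"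
    using rtrancl_imp_relpow exists_least_iff[of "\<lambda>n. (s, t) \<in> R ^^ n"] by (metis not_less)
  obtain f where f: "f 0 = s" "f n = t" and step: "\<And>i. i < n \<Longrightarrow> (f i, f (Suc i)) \<in> R"
    using n by (auto simp: relpow_fun_conv)
  have pre: "(s, f i) \<in> R ^^ i" if "i \<le> n" for i
    unfolding relpow_fun_conv using that f step by (intro exI[of _ f]) auto
  have post: "(f i, t) \<in> R ^^ (n - i)" if "i \<le> n" for i
    unfolding relpow_fun_conv using that f step by (intro exI[of _ "\<lambda>k. f (i + k)"]) auto
  \<comment> \<open>Prefixes and suffixes of the walk are spliced: a repeated vertex here, or a
    forward shortcut in \<open>chordless\<close>, would give a walk from \<open>s\<close> to
    \<open>t\<close> shorter than \<open>n\<close>.\<close>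
  have inj: "f i \<noteq> f j" if "i < j" "j \<le> n" for i j
  proof
    assume "f i = f j"
    then have "(s, t) \<in> R ^^ i O R ^^ (n - j)" using pre[of i] post[of j] that by auto
    then have "(s, t) \<in> R ^^ (i + (n - j))" by (simp only: relpow_add)
    then show False using least that by fastforce
  qed
  have chordless: "j = Suc i" if "i < j" "j \<le> n" "(f i, f j) \<in> R" for i j
  proof -
    have "(s, f j) \<in> R ^^ Suc i" using pre[of i] that by (auto intro: relpow_Suc_I)
    then have "(s, t) \<in> R ^^ Suc i O R ^^ (n - j)" using post[of j] that by blast
    then have "(s, t) \<in> R ^^ (Suc i + (n - j))" by (simp only: relpow_add)
    then have "n \<le> Suc i + (n - j)" by (rule least)
    then show ?thesis using that by simp
  qed
  have "n \<noteq> 0" using st f by metis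
  have "n \<noteq> 1"
  proof
    assume "n = 1"
    then have "(f 0, f n) \<in> R" using step[of 0] by simp
    then show False using st unfolding f by (simp add: R_def)
  qed
  have n2: "n \<ge> 2" using \<open>n \<noteq> 0\<close> \<open>n \<noteq> 1\<close> by simp
  have fmem: "f i \<in> insert s (insert t Q)" if "i \<le> n" for i
    using step[of i] f that by (cases "i = n") (auto simp: R_def)
  have interior: "f i \<in> Q" if "0 < i" "i < n" for i
    using fmem[of i] inj[of 0 i] inj[of i n] that f by auto
  have fv: "f i \<noteq> v" if "i \<le> n" for i
    using fmem[OF that] vs v by auto
  \<comment> \<open>The cycle is \<open>v\<close> followed by the path, so \<open>f i\<close> sits
    at index \<open>Suc i\<close>, and \<open>n \<ge> 2\<close> makes the length
    \<open>n + 2\<close> at least 4.\<close>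
  define vl where "vl = v # map f [0..<Suc n]"
  have len: "length vl = n + 2" by (simp add: vl_def)
  have nth0: "vl ! 0 = v" by (simp add: vl_def)
  have nthS: "vl ! Suc i = f i" if "i \<le> n" for i
    using that by (simp add: vl_def nth_append del: upt_Suc)
  have "inj_on f {0..n}"
    unfolding inj_on_def using inj by (metis atLeastAtMost_iff linorder_neqE_nat)
  moreover have "v \<notin> f ` {0..n}" using fv by fastforce
  ultimately have dist: "distinct vl"
    by (auto simp: vl_def distinct_map atLeastLessThanSuc_atLeastAtMost simp del: upt_Suc)
  have edges0: "{v, s} \<in> cycle_edges vl"
    unfolding cycle_edges_def using len nth0 nthS[of 0] f by (auto intro!: exI[of _ 0])
  have edgesS: "{f i, f (Suc i)} \<in> cycle_edges vl" if "i < n" for i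
    unfolding cycle_edges_def using len that nthS[of i] nthS[of "Suc i"] by (auto intro!: exI[of _ "Suc i"])
  have edgesn: "{v, t} \<in> cycle_edges vl"
    unfolding cycle_edges_def using len nth0 nthS[of n] f
    by (auto intro!: exI[of _ "Suc n"] simp: insert_commute)
  have "cycle_edges vl \<subseteq> E"
  proof
    fix e assume "e \<in> cycle_edges vl"
    then obtain i where i: "i < n + 2" "e = {vl ! i, vl ! (Suc i mod (n + 2))}"
      by (auto simp: cycle_edges_def len)
    consider "i = 0" | "i = Suc n" | k where "i = Suc k" "k < n"
      using i(1) by (cases i) (auto simp: less_Suc_eq)
    then show "e \<in> E"
    proof cases
      case 1 then show ?thesis using i nth0 nthS[of 0] f s by (auto simp: insert_commute)
    next
      case 2 then show ?thesis using i nth0 nthS[of n] f t by auto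
    next
      case 3 then show ?thesis using i nthS[of k] nthS[of "Suc k"] step[of k] by (auto simp: R_def)
    qed
  qed
  moreover have "length vl \<ge> 4" using len n2 by simp
  ultimately obtain e where e: "e \<in> E" "e \<subseteq> set vl" "e \<notin> cycle_edges vl"
    using assms(1) dist unfolding chordal_def by blast
  obtain a b where ab: "e = {a, b}" "a \<noteq> b" using loopless e(1) by (auto simp: card_2_iff)
  have set: "set vl = insert v (f ` {0..n})"
    by (auto simp: vl_def atLeastLessThanSuc_atLeastAtMost simp del: upt_Suc)
  \<comment> \<open>Inner vertices of the path lie in \<open>Q\<close> and are not adjacent to
    \<open>v\<close>; the path meets the neighbours of \<open>v\<close> only in \<open>s\<close> and
    \<open>t\<close>, which are next to \<open>v\<close> on the cycle.\<close>
  have no_v: "{v, f i} \<notin> E \<or> {v, f i} \<in> cycle_edges vl" if "i \<le> n" for i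
    using that interior[of i] vQ edges0 edgesn f by (cases "i = 0"; cases "i = n") auto
  have no_f: "{f i, f j} \<notin> E \<or> {f i, f j} \<in> cycle_edges vl" if "i < j" "j \<le> n" for i j
    using that chordless[of i j] fmem[of i] fmem[of j] edgesS[of i] by (auto simp: R_def)
  have "a = v \<or> (\<exists>i\<le>n. a = f i)" "b = v \<or> (\<exists>i\<le>n. b = f i)" using e(2) ab set by auto
  then consider i where "i \<le> n" "e = {v, f i}" | i j where "i < j" "j \<le> n" "e = {f i, f j}"
    using ab by (metis insert_commute linorder_neqE_nat)
  then show False using e no_v no_f by cases auto
qed

text \<open>For a non-universal vertex \<open>v\<close> and a component \<open>Q\<close> of its non-neighbours, the attachment of
  \<open>Q\<close> is a clique, so induction applies to \<open>Q\<close> with its attachment; choosing \<open>v\<close> in \<open>K\<close> if possible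
  keeps \<open>Q\<close> disjoint from \<open>K\<close>.\<close>

lemma chordal_simplicial_outside_clique:
  assumes "chordal E" and loopless: "\<forall>e\<in>E. card e = 2"
    and "finite U" "is_clique E K" "\<not> U \<subseteq> K"
  shows "\<exists>v. simplicial E U v \<and> v \<notin> K"
  using assms(3-)
proof (induction "card U" arbitrary: U K rule: less_induct)
  case less
  show ?case
  proof (cases "is_clique E U")
    case True
    then show ?thesis using less.prems by (auto simp: simplicial_def intro: is_clique_subset)
  next
    case False
    define nonuniv where "nonuniv = (\<lambda>v. v \<in> U \<and> (\<exists>u\<in>U. u \<noteq> v \<and> {u, v} \<notin> E))"
    have "\<exists>v. nonuniv v"
      using False by (auto simp: is_clique_iff nonuniv_def)
    then obtain v where v: "nonuniv v" and vK: "v \<in> K \<or> (\<forall>x\<in>K. \<not> nonuniv x)"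
      by metis
    let ?T = "U - insert v (neighbors E v)"
    have "?T \<noteq> {}" using v by (auto simp: nonuniv_def)
    then obtain Q where Q: "component E ?T Q"
      using component_exists less.prems by (metis finite_Diff)
    let ?N = "{s \<in> U. {s, v} \<in> E \<and> (\<exists>q\<in>Q. {s, q} \<in> E)}"
    have "is_clique E {s. {s, v} \<in> E \<and> (\<exists>q\<in>Q. {s, q} \<in> E)}"
      by (rule chordal_attachment_clique[OF assms(1) loopless])
        (use Q in \<open>auto simp: component_def no_edges_between_def insert_commute[of v]\<close>)
    then have N: "is_clique E ?N" by (rule is_clique_subset) auto
    have "Q \<subseteq> ?T" "Q \<noteq> {}" using Q by (simp_all add: component_def connected_set_def)
    then have QN: "Q \<inter> ?N = {}" "Q \<noteq> {}" "Q \<subseteq> U" "v \<notin> Q" by auto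
    have "{v, v} \<notin> E" using loopless by fastforce
    \<comment> \<open>\<open>v\<close> is missing on the left, so induction applies; with the clique
      \<open>?N\<close> it yields a simplicial vertex outside \<open>?N\<close>, hence in
      \<open>Q\<close>.\<close>
    then have "Q \<union> ?N \<subset> U" using QN v by (auto simp: nonuniv_def)
    then have "card (Q \<union> ?N) < card U" using less.prems(1) by (rule psubset_card_mono[rotated])
    moreover have "finite (Q \<union> ?N)" using less.prems(1) QN by (auto intro: finite_subset)
    ultimately obtain x where x: "simplicial E (Q \<union> ?N) x" "x \<notin> ?N"
      using less.hyps[of "Q \<union> ?N" ?N] N QN by blast
    then have xQ: "x \<in> Q" by (auto simp: simplicial_def)
    \<comment> \<open>A neighbour of \<open>x\<close> in \<open>U\<close> outside \<open>Q\<close>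
      must be adjacent to \<open>v\<close>, since otherwise it would belong to the component
      \<open>Q\<close>. So it lies in the attachment, and \<open>x\<close> is simplicial in all of
      \<open>U\<close>.\<close>
    have "neighbors E x \<inter> U \<subseteq> neighbors E x \<inter> (Q \<union> ?N)"
    proof (clarsimp, rule ccontr)
      fix y assume y: "{y, x} \<in> E" "y \<in> U" "y \<notin> Q" "\<not> ({y, v} \<in> E \<and> (\<exists>q\<in>Q. {y, q} \<in> E))"
      have "y \<noteq> v" using y(1) xQ Q by (auto simp: component_def insert_commute)
      moreover have "{y, v} \<notin> E" using y xQ by auto
      ultimately have "y \<in> ?T - Q" using y by auto
      then have "{x, y} \<notin> E" using Q xQ unfolding component_def no_edges_between_def by blast
      then show False using y(1) by (simp add: insert_commute)
    qed
    then have "simplicial E U x"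
      using x xQ QN by (auto simp: simplicial_def intro: is_clique_subset)
    moreover have "x \<notin> K"
    proof
      assume xK: "x \<in> K"
      have xv: "x \<in> U" "x \<noteq> v" "{x, v} \<notin> E" using Q xQ by (auto simp: component_def)
      \<comment> \<open>\<open>x\<close> and \<open>v\<close> are non-adjacent, so \<open>x\<close>
        would be a non-universal vertex of \<open>K\<close>; the choice of \<open>v\<close> then
        puts \<open>v\<close> into \<open>K\<close> too, where it would be adjacent to
        \<open>x\<close>.\<close>
      then have "nonuniv x" using v by (auto simp: nonuniv_def insert_commute intro!: bexI[of _ v])
      then have "v \<in> K" using vK xK by auto
      then show False using xv xK less.prems(2) by (auto simp: is_clique_iff)
    qed
    ultimately show ?thesis by blast
  qed
qed

lemma hereditarily_simplicial_if_chordal: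
  assumes "chordal E" "\<forall>e\<in>E. card e = 2"
  shows "hereditarily_simplicial E"
  unfolding hereditarily_simplicial_def
proof (intro allI impI)
  fix U :: "'a set" assume "finite U \<and> U \<noteq> {}"
  then show "\<exists>v. simplicial E U v"
    using chordal_simplicial_outside_clique[OF assms, of U "{}"] by (auto simp: is_clique_iff)
qed

section \<open>Gluing along cliques, complete graphs and induced subgraphs\<close>

lemma card_edge: "E \<subseteq> [V]\<^bsup>2\<^esup> \<Longrightarrow> \<forall>e\<in>E. card e = 2"
  by (auto simp: nsets_def)

text \<open>An edge of one graph between two vertices of the other has both ends in the common
  clique, so the union adds no edge inside \<open>V1\<close> or inside \<open>V2\<close>, and no
  edge joins the two differences. If \<open>U\<close> has a vertex in \<open>V1\<close> outside
  \<open>V2\<close>, a simplicial one can be chosen there, and all its edges are in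
  \<open>H1\<close>; otherwise only \<open>H2\<close> matters on \<open>U\<close>.\<close>

lemma glue_along_clique:
  assumes H1: "H1 \<subseteq> [V1]\<^bsup>2\<^esup>" "hereditarily_simplicial H1" "is_clique H1 (V1 \<inter> V2)"
    and H2: "H2 \<subseteq> [V2]\<^bsup>2\<^esup>" "hereditarily_simplicial H2" "is_clique H2 (V1 \<inter> V2)"
  shows "hereditarily_simplicial (H1 \<union> H2)"
    and "\<And>K. K \<subseteq> V1 \<union> V2 \<Longrightarrow> is_clique (H1 \<union> H2) K \<Longrightarrow>
      K \<subseteq> V1 \<and> is_clique H1 K \<or> K \<subseteq> V2 \<and> is_clique H2 K"
proof -
  have in1: "x \<in> V1 \<and> y \<in> V1 \<and> x \<noteq> y" if "{x, y} \<in> H1" for x y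
    using subsetD[OF H1(1) that] by (simp add: doubleton_mem_nsets)
  have in2: "x \<in> V2 \<and> y \<in> V2 \<and> x \<noteq> y" if "{x, y} \<in> H2" for x y
    using subsetD[OF H2(1) that] by (simp add: doubleton_mem_nsets)
  have to1: "{x, y} \<in> H1" if "{x, y} \<in> H1 \<union> H2" "x \<in> V1" "y \<in> V1" for x y
    using that in2[of x y] H1(3) by (auto simp: is_clique_iff)
  have to2: "{x, y} \<in> H2" if "{x, y} \<in> H1 \<union> H2" "x \<in> V2" "y \<in> V2" for x y
    using that in1[of x y] H2(3) by (auto simp: is_clique_iff)
  show "hereditarily_simplicial (H1 \<union> H2)"
    unfolding hereditarily_simplicial_def
  proof (intro allI impI, elim conjE)
    fix U :: "'a set" assume U: "finite U" "U \<noteq> {}"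
    show "\<exists>v. simplicial (H1 \<union> H2) U v"
    proof (cases "U \<inter> V1 \<subseteq> V1 \<inter> V2")
      case True
      obtain v where v: "simplicial H2 U v"
        using H2(2) U by (auto simp: hereditarily_simplicial_def)
      have "neighbors (H1 \<union> H2) v \<inter> U \<subseteq> neighbors H2 v \<inter> U"
      proof (rule subsetI, elim IntE)
        fix u assume u: "u \<in> neighbors (H1 \<union> H2) v" "u \<in> U"
        have "v \<in> U" using v by (simp add: simplicial_def)
        then have "u \<in> V2 \<and> v \<in> V2" using u True in1[of u v] in2[of u v] by auto
        then show "u \<in> neighbors H2 v \<inter> U" using u to2[of u v] by simp
      qed
      then have "simplicial (H1 \<union> H2) U v" using v is_clique_mono[OF is_clique_subset]
        unfolding simplicial_def by blast
      then show ?thesis by blast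
    next
      case False
      then obtain v where v: "simplicial H1 (U \<inter> V1) v" "v \<notin> V1 \<inter> V2"
        using chordal_simplicial_outside_clique[OF chordal_if_hereditarily_simplicial[OF H1(2)]
            card_edge[OF H1(1)], of "U \<inter> V1"] H1(3) U by blast
      have "neighbors (H1 \<union> H2) v \<inter> U \<subseteq> neighbors H1 v \<inter> (U \<inter> V1)"
      proof (rule subsetI, elim IntE)
        fix u assume u: "u \<in> neighbors (H1 \<union> H2) v" "u \<in> U"
        have "v \<in> V1" "v \<notin> V2" using v by (auto simp: simplicial_def)
        then have "{u, v} \<in> H1" using u in2[of u v] by auto
        then show "u \<in> neighbors H1 v \<inter> (U \<inter> V1)" using u in1[of u v] by simp
      qed
      then have "simplicial (H1 \<union> H2) U v" using v is_clique_mono[OF is_clique_subset]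
        unfolding simplicial_def by blast
      then show ?thesis by blast
    qed
  qed
  fix K assume K: "K \<subseteq> V1 \<union> V2" "is_clique (H1 \<union> H2) K"
  have "K \<subseteq> V1 \<or> K \<subseteq> V2"
  proof (rule ccontr)
    assume "\<not> (K \<subseteq> V1 \<or> K \<subseteq> V2)"
    then obtain a b where ab: "a \<in> K" "a \<notin> V1" "b \<in> K" "b \<notin> V2" by auto
    then have "a \<noteq> b" using K by auto
    then have "{a, b} \<in> H1 \<union> H2" using K ab by (simp add: is_clique_iff)
    then show False using in1[of a b] in2[of a b] ab by auto
  qed
  moreover have "is_clique H1 K" if "K \<subseteq> V1"
    unfolding is_clique_iff using K(2) to1 that by (meson is_cliqueD subsetD)
  moreover have "is_clique H2 K" if "K \<subseteq> V2"
    unfolding is_clique_iff using K(2) to2 that by (meson is_cliqueD subsetD)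
  ultimately show "K \<subseteq> V1 \<and> is_clique H1 K \<or> K \<subseteq> V2 \<and> is_clique H2 K" by blast
qed

lemma hereditarily_simplicial_complete: "hereditarily_simplicial ([S]\<^bsup>2\<^esup>)"
  unfolding hereditarily_simplicial_def
proof (intro allI impI, elim conjE)
  fix U :: "'a set" assume "U \<noteq> {}"
  then obtain v where "v \<in> U" by auto
  then have "simplicial ([S]\<^bsup>2\<^esup>) U v"
    by (auto simp: simplicial_def is_clique_iff doubleton_mem_nsets)
  then show "\<exists>v. simplicial ([S]\<^bsup>2\<^esup>) U v" by blast
qed

lemma induced_edges_subset: "E \<subseteq> [V]\<^bsup>2\<^esup> \<Longrightarrow> induced_edges E S \<subseteq> [S]\<^bsup>2\<^esup>"
  by (auto simp: induced_edges_def nsets_def)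

text \<open>A set \<open>U\<close> inside \<open>S\<close> sees the same edges as before; otherwise
  any vertex of \<open>U\<close> outside \<open>S\<close> is isolated.\<close>

lemma hereditarily_simplicial_induced:
  assumes "hereditarily_simplicial E"
  shows "hereditarily_simplicial (induced_edges E S)"
  unfolding hereditarily_simplicial_def
proof (intro allI impI, elim conjE)
  fix U :: "'a set" assume U: "finite U" "U \<noteq> {}"
  show "\<exists>v. simplicial (induced_edges E S) U v"
  proof (cases "U \<subseteq> S")
    case True
    then show ?thesis using assms U
      by (fastforce simp: hereditarily_simplicial_def simplicial_def is_clique_iff induced_edges_def)
  next
    case False
    then obtain v where "v \<in> U" "v \<notin> S" by auto
    then have "simplicial (induced_edges E S) U v"
      by (auto simp: simplicial_def is_clique_iff induced_edges_def)
    then show ?thesis by blast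
  qed
qed

section \<open>The minimum weight heuristic\<close>

lemma min_weight_fill_exists:
  assumes "finite V"
  shows "\<exists>F. min_weight_fill w V E F"
  using assms
proof (induction "card V" arbitrary: V E rule: less_induct)
  case less
  show ?case
  proof (cases "V = {}")
    case True
    then show ?thesis by (auto intro: min_weight_fill.empty)
  next
    case False
    let ?f = "\<lambda>v. sum w ({v} \<union> neighbors E v)"
    let ?v = "arg_min_on ?f V"
    have v: "?v \<in> V" "\<forall>u\<in>V. ?f ?v \<le> ?f u"
      using arg_min_if_finite(1)[OF less.prems False, of ?f] arg_min_least[OF less.prems False, of _ ?f]
      by blast+
    have "card (V - {?v}) < card V" using v less.prems by (meson card_Diff1_less)
    then obtain F where
      "min_weight_fill w (V - {?v}) (induced_edges (E \<union> [neighbors E ?v]\<^bsup>2\<^esup>) (V - {?v})) F"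
      using less.hyps less.prems by blast
    then show ?thesis using min_weight_fill.eliminate[OF v] by blast
  qed
qed

text \<open>Elimination makes the neighbours of \<open>v\<close> a clique and later fill edges avoid
  \<open>v\<close>, so \<open>v\<close> is simplicial in every \<open>U\<close> containing it. A set
  \<open>U\<close> avoiding \<open>v\<close> sees only the graph that remains after the
  elimination.\<close>

lemma min_weight_fill_triangulates:
  assumes "min_weight_fill w V E F" "E \<subseteq> [V]\<^bsup>2\<^esup>"
  shows "F \<subseteq> [V]\<^bsup>2\<^esup> \<and> hereditarily_simplicial (E \<union> F)"
  using assms
proof (induction rule: min_weight_fill.induct)
  case (empty E)
  then have "E = {}" by (auto simp: nsets_def)
  then show ?case by (auto simp: hereditarily_simplicial_def simplicial_def is_clique_iff)
next
  case (eliminate v V E F)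
  let ?N = "neighbors E v" and ?V = "V - {v}"
  let ?E' = "induced_edges (E \<union> [?N]\<^bsup>2\<^esup>) ?V"
  have N: "?N \<subseteq> ?V" using eliminate.prems by (auto simp: nsets_def card_insert_if)
  have NV: "[?N]\<^bsup>2\<^esup> \<subseteq> [?V]\<^bsup>2\<^esup>" using N by (rule nsets_mono)
  have VV: "[?V]\<^bsup>2\<^esup> \<subseteq> [V]\<^bsup>2\<^esup>" by (rule nsets_mono) auto
  have "?E' \<subseteq> [?V]\<^bsup>2\<^esup>" by (rule induced_edges_subset[of _ V]) (use eliminate.prems NV VV in blast)
  then have IH: "F \<subseteq> [?V]\<^bsup>2\<^esup>" "hereditarily_simplicial (?E' \<union> F)" using eliminate.IH by auto
  let ?H = "E \<union> ([?N]\<^bsup>2\<^esup> \<union> F)"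
  have "hereditarily_simplicial ?H"
    unfolding hereditarily_simplicial_def
  proof (intro allI impI, elim conjE)
    fix U :: "'a set" assume U: "finite U" "U \<noteq> {}"
    show "\<exists>v. simplicial ?H U v"
    proof (cases "v \<in> U")
      case True
      have "{u, v} \<notin> [?V]\<^bsup>2\<^esup>" for u by (simp add: doubleton_mem_nsets)
      then have "neighbors ?H v \<subseteq> ?N" using NV IH(1) by auto
      moreover have "is_clique ?H ?N" by (auto simp: is_clique_def)
      ultimately have "simplicial ?H U v" using True
        by (auto simp: simplicial_def intro: is_clique_subset)
      then show ?thesis by blast
    next
      case False
      have eq: "{x, y} \<in> ?H \<longleftrightarrow> {x, y} \<in> ?E' \<union> F" if "x \<in> U" "y \<in> U" for x y
      proof -
        have "{x, y} \<subseteq> V" if "{x, y} \<in> E \<union> [?N]\<^bsup>2\<^esup>"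
          using that eliminate.prems NV VV by (auto simp: nsets_def)
        then show ?thesis using that False by (auto simp: induced_edges_def)
      qed
      obtain u where "simplicial (?E' \<union> F) U u"
        using IH(2) U by (auto simp: hereditarily_simplicial_def)
      then have "simplicial ?H U u"
        unfolding simplicial_def is_clique_iff Int_iff Ball_def mem_neighbors using eq by meson
      then show ?thesis by blast
    qed
  qed
  then show ?case using IH(1) NV VV by blast
qed

section \<open>Clique separators of chordal graphs\<close>

text \<open>A walk through \<open>v\<close> can bypass it, as neighbours of \<open>v\<close> are
  adjacent. In cut form: if a part \<open>P\<close> cut off from the rest of \<open>Q - {v}\<close>
  has a neighbour \<open>p\<close> of \<open>v\<close>, any further neighbour of \<open>v\<close>
  would be adjacent to \<open>p\<close>, so \<open>insert v P\<close> is cut off in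
  \<open>Q\<close>.\<close>

lemma connected_set_remove_simplicial:
  assumes Q: "connected_set E Q" and v: "simplicial E U v" and "Q \<subseteq> U" "v \<in> Q" "Q \<noteq> {v}"
  shows "connected_set E (Q - {v})"
proof -
  have "P = Q - {v}" if P: "P \<subseteq> Q - {v}" "P \<noteq> {}" "no_edges_between E P (Q - {v} - P)" for P
  proof (cases "\<exists>p\<in>P. {p, v} \<in> E")
    case False
    then have "no_edges_between E P (Q - P)" using P by (auto simp: no_edges_between_def)
    then have "P = Q" using connected_setD[OF Q, of P] P by blast
    then show ?thesis using P assms(4) by blast
  next
    case True
    then obtain p where p: "p \<in> P" "{p, v} \<in> E" by blast
    have "{v, r} \<notin> E" if r: "r \<in> Q - {v} - P" for r
    proof
      assume "{v, r} \<in> E"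
      then have "{r, v} \<in> E" by (simp add: insert_commute)
      then have "{p, r} \<in> E" using v p r P assms(3) unfolding simplicial_def
        by (intro is_cliqueD[of E "neighbors E v \<inter> U"]) auto
      then show False using P(3) p r by (auto simp: no_edges_between_def)
    qed
    then have "no_edges_between E (insert v P) (Q - insert v P)"
      using P(3) unfolding no_edges_between_def by blast
    then have "insert v P = Q" using connected_setD[OF Q, of "insert v P"] P assms(4) by blast
    then show ?thesis using P by blast
  qed
  then show ?thesis using assms(4,5) unfolding connected_set_def by blast
qed

text \<open>Take a simplicial vertex \<open>v\<close> of \<open>Q \<union> S\<close>. If
  \<open>v\<close> is in \<open>S\<close>, any neighbour of \<open>v\<close> in \<open>Q\<close>
  works. If \<open>v\<close> is in \<open>Q\<close> and not alone there, it can be removed: a vertex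
  of \<open>S\<close> attached through \<open>v\<close> is also adjacent to every other neighbour of
  \<open>v\<close> in \<open>Q\<close>.\<close>

lemma attached_clique_common_neighbor:
  assumes hs: "hereditarily_simplicial E"
    and "finite Q" "finite S" "connected_set E Q" "is_clique E S" "S \<inter> Q = {}"
    and "\<forall>s\<in>S. \<exists>q\<in>Q. {s, q} \<in> E"
  shows "\<exists>q\<in>Q. \<forall>s\<in>S. {s, q} \<in> E"
  using assms(2-)
proof (induction "card Q" arbitrary: Q rule: less_induct)
  case less
  have "Q \<union> S \<noteq> {}" using less.prems(3) by (auto simp: connected_set_def)
  then obtain v where v: "simplicial E (Q \<union> S) v"
    using hs less.prems(1,2) unfolding hereditarily_simplicial_def by (meson finite_UnI)
  have clique: "{x, y} \<in> E" if "{x, v} \<in> E" "{y, v} \<in> E" "x \<in> Q \<union> S" "y \<in> Q \<union> S" "x \<noteq> y" for x y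
    using v that unfolding simplicial_def by (intro is_cliqueD[of E "neighbors E v \<inter> (Q \<union> S)"]) auto
  show ?case
  proof (cases "v \<in> S")
    case True
    then obtain q where q: "q \<in> Q" "{v, q} \<in> E" using less.prems by blast
    have "{s, q} \<in> E" if "s \<in> S" for s
    proof (cases "s = v")
      case True then show ?thesis using q by simp
    next
      case False
      then have "{s, v} \<in> E" using less.prems(4) \<open>v \<in> S\<close> that by (simp add: is_clique_iff)
      moreover have "s \<noteq> q" using that q less.prems(5) by blast
      moreover have "{q, v} \<in> E" using q by (simp add: insert_commute)
      ultimately show ?thesis using clique that q by blast
    qed
    then show ?thesis using q by blast
  next
    case False
    then have vQ: "v \<in> Q" using v by (auto simp: simplicial_def)
    show ?thesis
    proof (cases "Q = {v}")
      case True
      then show ?thesis using less.prems by auto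
    next
      case False
      have "\<not> no_edges_between E {v} (Q - {v})"
        using connected_setD[OF less.prems(3), of "{v}"] False vQ by blast
      then obtain u where u: "u \<in> Q - {v}" "{v, u} \<in> E" by (auto simp: no_edges_between_def)
      have u': "{u, v} \<in> E" using u by (simp add: insert_commute)
      have "\<exists>q\<in>Q - {v}. {s, q} \<in> E" if s: "s \<in> S" for s
      proof -
        obtain q where q: "q \<in> Q" "{s, q} \<in> E" using less.prems s by blast
        show ?thesis
        proof (cases "q = v")
          case True
          moreover have "s \<noteq> u" using s u less.prems(5) by blast
          ultimately have "{s, u} \<in> E" using clique[of s u] q u u' s by blast
          then show ?thesis using u by blast
        next
          case False
          then show ?thesis using q by blast
        qed
      qed
      moreover have "connected_set E (Q - {v})"
        using connected_set_remove_simplicial[OF less.prems(3) v] vQ False by blast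
      moreover have "card (Q - {v}) < card Q" using vQ less.prems by (meson card_Diff1_less)
      moreover have "S \<inter> (Q - {v}) = {}" "finite (Q - {v})" using less.prems by auto
      ultimately have "\<exists>q\<in>Q - {v}. \<forall>s\<in>S. {s, q} \<in> E"
        using less.hyps[of "Q - {v}"] less.prems(2,4) by blast
      then show ?thesis by blast
    qed
  qed
qed

text \<open>A heavy component \<open>Q\<close> of the complement of a clique shrinks when the clique is replaced by the
  attachment of \<open>Q\<close> together with a common neighbour in \<open>Q\<close>; two heavy components cannot be
  disjoint.\<close>

lemma balanced_clique_exists:
  fixes u :: "'a \<Rightarrow> real"
  assumes hs: "hereditarily_simplicial E" and "finite V" and u: "\<forall>v\<in>V. u v \<ge> 0"
  shows "\<exists>X\<subseteq>V. is_clique E X \<and> (\<forall>Q. component E (V - X) Q \<longrightarrow> 2 * sum u Q \<le> sum u V)"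
proof (rule ccontr)
  assume neg: "\<not> ?thesis"
  let ?P = "\<lambda>X Q. X \<subseteq> V \<and> is_clique E X \<and> component E (V - X) Q \<and> 2 * sum u Q > sum u V"
  have ex: "\<exists>Q. ?P X Q" if "X \<subseteq> V" "is_clique E X" for X
    using neg that by (meson not_le)
  have "\<exists>Q. ?P {} Q" by (rule ex) (auto simp: is_clique_iff)
  \<comment> \<open>Among all pairs of a clique and a heavy component, one with the smallest
    component is taken.\<close>
  then have "\<exists>n X Q. ?P X Q \<and> card Q = n" by blast
  then obtain n where "\<exists>X Q. ?P X Q \<and> card Q = n"
    and least: "\<And>k. k < n \<Longrightarrow> \<not> (\<exists>X Q. ?P X Q \<and> card Q = k)"
    using exists_least_iff[of "\<lambda>n. \<exists>X Q. ?P X Q \<and> card Q = n"] by blast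
  then obtain X Q where XV: "X \<subseteq> V" and X: "is_clique E X" and comp: "component E (V - X) Q"
    and heavy: "2 * sum u Q > sum u V" and n: "card Q = n" by blast
  have QV: "Q \<subseteq> V - X" and conn: "connected_set E Q" and closed: "no_edges_between E Q (V - X - Q)"
    using comp by (auto simp: component_def)
  have finQ: "finite Q" "finite X" using QV XV assms(2) by (auto intro: finite_subset)
  let ?S = "{s \<in> X. \<exists>q\<in>Q. {s, q} \<in> E}"
  have S: "is_clique E ?S" using X by (rule is_clique_subset) blast
  obtain q where q: "q \<in> Q" "\<forall>s\<in>?S. {s, q} \<in> E"
  proof -
    have "finite ?S" "?S \<inter> Q = {}" "\<forall>s\<in>?S. \<exists>q\<in>Q. {s, q} \<in> E" using finQ(2) QV by auto
    from attached_clique_common_neighbor[OF hs finQ(1) this(1) conn S this(2,3)] that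
    show thesis by meson
  qed
  have "is_clique E (insert q ?S)"
    using S q(2) by (auto simp: is_clique_iff insert_commute)
  then obtain Q' where Q': "component E (V - insert q ?S) Q'" "2 * sum u Q' > sum u V"
    using ex[of "insert q ?S"] XV QV q by blast
  have Q'V: "Q' \<subseteq> V - insert q ?S" and conn': "connected_set E Q'" using Q' by (auto simp: component_def)
  have finQ': "finite Q'" using Q'V assms(2) by (auto intro: finite_subset)
  have "Q' \<inter> Q \<noteq> {}"
  proof
    assume "Q' \<inter> Q = {}"
    then have "sum u Q' + sum u Q = sum u (Q' \<union> Q)"
      using finQ finQ' by (simp add: sum.union_disjoint)
    also have "\<dots> \<le> sum u V" using u Q'V QV assms(2) by (intro sum_mono2) auto
    finally show False using heavy Q'(2) by linarith
  qed
  moreover have "no_edges_between E (Q' \<inter> Q) (Q' - Q' \<inter> Q)"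
    unfolding no_edges_between_def
  proof (intro ballI notI)
    fix a b assume ab: "a \<in> Q' \<inter> Q" "b \<in> Q' - Q' \<inter> Q" "{a, b} \<in> E"
    \<comment> \<open>Edges leaving \<open>Q\<close> inside \<open>V\<close> end in
      \<open>X\<close>, hence in \<open>?S\<close>, which \<open>Q'\<close> avoids; so the connected
      \<open>Q'\<close>, which meets \<open>Q\<close>, lies within \<open>Q\<close>, and it misses
      \<open>q\<close>.\<close>
    have "b \<in> X" using ab closed Q'V unfolding no_edges_between_def by blast
    moreover have "{b, a} \<in> E" using ab by (simp add: insert_commute)
    ultimately have "b \<in> ?S" using ab by blast
    then show False using ab Q'V by blast
  qed
  ultimately have "Q' \<inter> Q = Q'" using connected_setD[OF conn', of "Q' \<inter> Q"] by blast
  then have "Q' \<subset> Q" using q Q'V by blast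
  then have "card Q' < n" using finQ n by (metis psubset_card_mono)
  moreover have "?P (insert q ?S) Q'" using Q' \<open>is_clique E (insert q ?S)\<close> XV QV q by blast
  ultimately show False using least by blast
qed

text \<open>Fill the first bin \<open>A\<close> with a largest closed set of weight at most
  \<open>h\<close>, and the second with one further component \<open>B\<close>. Maximality gives
  \<open>A \<union> B\<close> weight above \<open>h\<close>, which leaves at most \<open>h\<close>
  for the rest.\<close>

lemma components_three_bins:
  fixes u :: "'a \<Rightarrow> real"
  assumes "finite T" "T \<noteq> {}" "\<not> connected_set E T" and u: "\<forall>v\<in>T. u v \<ge> 0"
    and comp: "\<And>Q. component E T Q \<Longrightarrow> sum u Q \<le> h" and tot: "sum u T \<le> 2 * h"
  obtains A B C where "A \<union> B \<union> C = T" "A \<inter> B = {}" "A \<inter> C = {}" "B \<inter> C = {}" "A \<noteq> {}" "B \<noteq> {}"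
    "no_edges_between E A B" "no_edges_between E A C" "no_edges_between E B C"
    "sum u A \<le> h" "sum u B \<le> h" "sum u C \<le> h"
proof -
  have fin: "finite Q" if "Q \<subseteq> T" for Q using that assms(1) by (rule finite_subset)
  let ?P = "\<lambda>A. A \<subseteq> T \<and> no_edges_between E A (T - A) \<and> sum u A \<le> h"
  have "0 \<le> h" using sum_nonneg[of T u] u tot by force
  then have P0: "?P {}" by (simp add: no_edges_between_def)
  have bound: "card A \<le> card T" if "?P A" for A using that assms(1) by (auto intro: card_mono)
  obtain A where A: "?P A" and max: "\<And>B. ?P B \<Longrightarrow> card B \<le> card A"
    using ex_has_greatest_nat[of ?P "{}" card "Suc (card T)"] P0 bound by (metis less_Suc_eq_le)
  show thesis
  proof (cases "A = T")
    case True
    \<comment> \<open>All of \<open>T\<close> fits into one bin, so any cut of the disconnected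
      \<open>T\<close> serves, with the third bin empty.\<close>
    obtain B where B: "B \<subseteq> T" "B \<noteq> {}" "no_edges_between E B (T - B)" "B \<noteq> T"
      using assms(2,3) unfolding connected_set_def by blast
    have "sum u B \<le> sum u T" "sum u (T - B) \<le> sum u T"
      using u assms(1) B by (auto intro!: sum_mono2)
    then have "sum u B \<le> h" "sum u (T - B) \<le> h" using A True by auto
    with B \<open>0 \<le> h\<close> show thesis
      by (intro that[of B "T - B" "{}"]) (auto simp: no_edges_between_def)
  next
    case False
    then obtain B where B: "component E (T - A) B"
      using component_exists[of "T - A" E] A assms(1) by blast
    have BT: "B \<subseteq> T - A" "B \<noteq> {}" "no_edges_between E B (T - A - B)"
      using B by (auto simp: component_def connected_set_def)
    have AB: "no_edges_between E A B"
      using A BT by (auto simp: no_edges_between_def)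
    then have BA: "no_edges_between E B A" by (simp add: no_edges_between_commute)
    then have closed: "no_edges_between E B (T - B)"
      using BT unfolding no_edges_between_def by blast
    then have "component E T B" using B BT by (auto simp: component_def)
    then have hB: "sum u B \<le> h" by (rule comp)
    have cl: "no_edges_between E (A \<union> B) (T - (A \<union> B))"
      using A closed unfolding no_edges_between_def by blast
    have "card (A \<union> B) > card A"
      using BT A fin by (intro psubset_card_mono) auto
    then have "\<not> ?P (A \<union> B)" using max[of "A \<union> B"] by auto
    then have h: "sum u (A \<union> B) > h" using cl A BT by auto
    \<comment> \<open>\<open>B\<close> alone weighs at most \<open>h\<close>, so the overflow needs
      a contribution from \<open>A\<close>.\<close>
    have "A \<noteq> {}" using h hB by auto
    have "A \<union> B \<subseteq> T" using A BT by blast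
    then have "sum u T = sum u (T - (A \<union> B)) + sum u (A \<union> B)"
      using assms(1) by (rule sum.subset_diff)
    then have "sum u (T - (A \<union> B)) \<le> h" using h tot by linarith
    with A BT AB hB cl \<open>A \<noteq> {}\<close> show thesis
      by (intro that[of A B "T - (A \<union> B)"]) (auto simp: no_edges_between_def)
  qed
qed

lemma weighted_decomposition_exists:
  fixes w :: "'a \<Rightarrow> real"
  assumes "finite V" "E \<subseteq> H" "H \<subseteq> [V]\<^bsup>2\<^esup>" "chordal H"
    and cliques: "\<And>K. K \<subseteq> V \<Longrightarrow> is_clique H K \<Longrightarrow> sum w K \<le> m"
    and w: "\<forall>v\<in>V. w v \<ge> 0"
    and "\<alpha> \<ge> 1" "m > 0" "W \<subseteq> V" and W: "sum w W < (\<alpha> + 1) * m"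
    and V: "sum w V \<ge> (2 * \<alpha> + 1) * m"
  shows "\<exists>X A B C. weighted_decomposition w m \<alpha> V E W X A B C"
proof -
  have hs: "hereditarily_simplicial H"
    using hereditarily_simplicial_if_chordal[OF assms(4) card_edge[OF assms(3)]] .
  \<comment> \<open>\<open>u\<close> is \<open>w\<close> restricted to \<open>W\<close>, so that
    balancing \<open>u\<close> over \<open>V\<close> balances the weight of
    \<open>W\<close>.\<close>
  define u where "u = (\<lambda>v. if v \<in> W then w v else 0)"
  define h where "h = sum w W / 2"
  have u: "\<forall>v\<in>V. u v \<ge> 0" using w by (simp add: u_def)
  have sum_u: "sum u P = sum w (W \<inter> P)" if "P \<subseteq> V" for P
    using sum.inter_restrict[of P w W] finite_subset[OF that assms(1)] by (simp add: u_def Int_commute)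
  have sumV: "sum u V = 2 * h" using sum_u[of V] assms(9) by (simp add: h_def Int_absorb2)
  have am: "m \<le> \<alpha> * m" using assms(7,8) by simp
  have a1: "m < (\<alpha> + 1) * m" and a2: "m < (2 * \<alpha> + 1) * m" using am assms(8) by (simp_all add: algebra_simps)
  have hm: "h + m < (\<alpha> + 1) * m" using W am by (simp add: h_def algebra_simps)
  have mono: "sum w P \<le> sum w R" if "P \<subseteq> R" "R \<subseteq> V" for P R
    using that w assms(1) by (intro sum_mono2) (auto intro: finite_subset)
  have un: "sum w ((W \<inter> P) \<union> R) \<le> sum u P + sum w R" if "P \<subseteq> V" "R \<subseteq> V" for P R
  proof -
    have "finite P" "finite R" using that assms(1) by (auto intro: finite_subset)
    moreover have "sum w (W \<inter> P \<inter> R) \<ge> 0" using that w by (intro sum_nonneg) auto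
    ultimately show ?thesis using sum_u[OF that(1)] sum_Un[of "W \<inter> P" R w] by auto
  qed
  define good where "good = (\<lambda>X. X \<subseteq> V \<and> is_clique H X \<and>
    (\<forall>Q. component H (V - X) Q \<longrightarrow> sum u Q \<le> h))"
  obtain X0 where "good X0"
    using balanced_clique_exists[OF hs assms(1) u] sumV by (auto simp: good_def)
  moreover have "\<forall>X. good X \<longrightarrow> card X < Suc (card V)"
    using assms(1) by (auto simp: good_def less_Suc_eq_le intro: card_mono)
  ultimately obtain X where X: "good X" and max: "\<And>Y. good Y \<Longrightarrow> card Y \<le> card X"
    using ex_has_greatest_nat[of good X0 card] by blast
  have XV: "X \<subseteq> V" and Xc: "is_clique H X" using X by (auto simp: good_def)
  have wX: "sum w X \<le> m" using cliques XV Xc .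
  have ne: "V - X \<noteq> {}"
  proof
    \<comment> \<open>Otherwise \<open>V\<close> would be a clique of weight at most
      \<open>m\<close>, below the assumed total weight.\<close>
    assume "V - X = {}"
    then have "X = V" using XV by blast
    then have "sum w V \<le> m" using wX by simp
    then show False using V a2 by linarith
  qed
  have to_E: "no_edges_between E P R" if "no_edges_between H P R" for P R
    using that assms(2) by (auto simp: no_edges_between_def)
  show ?thesis
  proof (cases "connected_set H (V - X)")
    case False
    obtain A B C where ABC: "A \<union> B \<union> C = V - X" "A \<inter> B = {}" "A \<inter> C = {}" "B \<inter> C = {}" "A \<noteq> {}" "B \<noteq> {}"
      "no_edges_between H A B" "no_edges_between H A C" "no_edges_between H B C"
      "sum u A \<le> h" "sum u B \<le> h" "sum u C \<le> h"
    proof (rule components_three_bins[of "V - X" H u h])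
      show "sum u (V - X) \<le> 2 * h"
        using sum_mono2[of V "V - X" u] u assms(1) sumV by auto
      show "\<And>Q. component H (V - X) Q \<Longrightarrow> sum u Q \<le> h" using X by (auto simp: good_def)
    qed (use ne False u assms(1) in auto)
    have "sum w ((W \<inter> P) \<union> X) < (\<alpha> + 1) * m" if "P \<subseteq> V" "sum u P \<le> h" for P
      using un[OF that(1) XV] that wX hm by linarith
    moreover have "A \<subseteq> V" "B \<subseteq> V" "C \<subseteq> V" using ABC by auto
    moreover have "decomposition V E X A B C"
      using ABC XV to_E unfolding decomposition_def by blast
    moreover have "sum w X \<le> \<alpha> * m" using wX am by linarith
    ultimately have "weighted_decomposition w m \<alpha> V E W X A B C"
      using V W ABC unfolding weighted_decomposition_def by blast
    then show ?thesis by blast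
  next
    case True
    let ?Q = "V - X"
    let ?S = "{s \<in> X. \<exists>q\<in>?Q. {s, q} \<in> H}"
    have Qh: "sum u ?Q \<le> h"
      using X True by (auto simp: good_def component_def no_edges_between_def)
    have "?S \<noteq> X"
    proof
      assume S: "?S = X"
      have fin: "finite X" "finite ?Q" using XV assms(1) by (auto intro: finite_subset)
      obtain q where q: "q \<in> ?Q" "\<forall>s\<in>X. {s, q} \<in> H"
        using attached_clique_common_neighbor[OF hs fin(2,1) True Xc] S by blast
      have "is_clique H (insert q X)" using Xc q(2) by (auto simp: is_clique_iff insert_commute)
      moreover have "sum u Q \<le> h" if "component H (V - insert q X) Q" for Q
      proof -
        have "Q \<subseteq> ?Q" using that by (auto simp: component_def)
        then have "sum u Q \<le> sum u ?Q" using u fin by (intro sum_mono2) auto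
        then show ?thesis using Qh by linarith
      qed
      ultimately have "good (insert q X)" using q XV by (auto simp: good_def)
      then have "card (insert q X) \<le> card X" by (rule max)
      then show False using q fin by auto
    qed
    then have ne': "X - ?S \<noteq> {}" by blast
    have SX: "?S \<subseteq> X" "?S \<subseteq> V" using XV by auto
    have nb: "no_edges_between H (X - ?S) ?Q" by (auto simp: no_edges_between_def)
    have wS: "sum w ?S \<le> m" using mono[OF SX(1) XV] wX by linarith
    \<comment> \<open>The single component and the unattached part of the clique become the two
      non-empty sides; the third side is empty.\<close>
    have dec: "decomposition V E ?S (X - ?S) ?Q {}"
      unfolding decomposition_def
      using XV ne ne' to_E[OF nb] by (auto simp: no_edges_between_def)
    \<comment> \<open>On the side of the clique everything stays inside \<open>X\<close>, so the
      clique bound \<open>m\<close> suffices.\<close>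
    have "sum w ((W \<inter> (X - ?S)) \<union> ?S) \<le> sum w X" using XV by (intro mono) auto
    then have 1: "sum w ((W \<inter> (X - ?S)) \<union> ?S) < (\<alpha> + 1) * m" using wX a1 by linarith
    have 2: "sum w ((W \<inter> ?Q) \<union> ?S) < (\<alpha> + 1) * m"
      using un[of ?Q ?S] SX Qh wS hm by auto
    have 3: "sum w ((W \<inter> {}) \<union> ?S) < (\<alpha> + 1) * m" using wS a1 by simp
    have 4: "sum w ?S \<le> \<alpha> * m" using wS am by linarith
    have "weighted_decomposition w m \<alpha> V E W ?S (X - ?S) ?Q {}"
      unfolding weighted_decomposition_def using V dec W 4 1 2 3 by blast
    then show ?thesis by blast
  qed
qed

section \<open>The recursive algorithm\<close>

text \<open>Each call omits \<open>A\<close> or \<open>B\<close>, both non-empty; this drives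
  termination and the existence of a run.\<close>

lemma part_psubset:
  assumes "weighted_decomposition w m \<alpha> V E W X A B C" "P \<in> {A, B, C}"
  shows "P \<union> X \<subset> V"
proof -
  have "X \<union> A \<union> B \<union> C = V" "X \<inter> A = {}" "X \<inter> B = {}" "A \<inter> B = {}" "A \<inter> C = {}" "B \<inter> C = {}"
    "A \<noteq> {}" "B \<noteq> {}"
    using assms(1) by (simp_all add: weighted_decomposition_def decomposition_def)
  then show ?thesis using assms(2) by auto
qed

lemma recursive_call_accp:
  assumes "finite V"
  shows "Wellfounded.accp (recursive_call w m \<alpha>) (V, E, W)"
  using assms
proof (induction "card V" arbitrary: V E W rule: less_induct)
  case less
  show ?case
  proof (rule accp.accI)
    fix y assume "recursive_call w m \<alpha> y (V, E, W)"
    then show "Wellfounded.accp (recursive_call w m \<alpha>) y"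
    proof cases
      case (1 X A B C P)
      then have "P \<union> X \<subset> V" using part_psubset by metis
      then have "card (P \<union> X) < card V" "finite (P \<union> X)"
        using less.prems by (auto intro: psubset_card_mono finite_subset)
      then show ?thesis using less.hyps 1 by blast
    qed
  qed
qed

lemma W_Triangulate_exists:
  assumes "finite V"
  shows "\<exists>r. W_Triangulate w m \<alpha> V E W r"
  using assms
proof (induction "card V" arbitrary: V E W rule: less_induct)
  case less
  show ?case
  proof (cases "sum w V < (2 * \<alpha> + 1) * m")
    case True
    then show ?thesis using min_weight_fill_exists[OF less.prems] W_Triangulate.small by blast
  next
    case False
    then have ge: "sum w V \<ge> (2 * \<alpha> + 1) * m" by simp
    show ?thesis
    proof (cases "\<exists>X A B C. weighted_decomposition w m \<alpha> V E W X A B C")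
      case True
      then obtain X A B C where d: "weighted_decomposition w m \<alpha> V E W X A B C" by blast
      have "\<exists>r. W_Triangulate w m \<alpha> (P \<union> X) E' W' r" if "P \<in> {A, B, C}" for P E' W'
      proof -
        have "P \<union> X \<subset> V" using part_psubset[OF d that] .
        then have "card (P \<union> X) < card V" "finite (P \<union> X)"
          using less.prems by (auto intro: psubset_card_mono finite_subset)
        then show ?thesis using less.hyps by blast
      qed
      then show ?thesis using W_Triangulate.split[OF ge d] by (meson insertCI)
    next
      case False
      then show ?thesis using W_Triangulate.not_found[OF ge] by blast
    qed
  qed
qed

text \<open>States a cliquewidth of at most \<open>m\<close> without \<open>Min\<close> and
  \<open>Max\<close>, in a form that passes directly to induced subgraphs.\<close>

definition admits_narrow_triangulation ::
    "('a \<Rightarrow> real) \<Rightarrow> real \<Rightarrow> 'a set \<Rightarrow> 'a set set \<Rightarrow> bool" where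
  "admits_narrow_triangulation w m V E \<longleftrightarrow>
    (\<exists>H. triangulation V E H \<and> (\<forall>K\<subseteq>V. is_clique H K \<longrightarrow> sum w K \<le> m))"

text \<open>Carries a failure of a recursive call up to its caller: restricting a triangulation to
  \<open>S\<close> keeps it chordal and creates no new cliques.\<close>

lemma admits_narrow_triangulation_induced:
  assumes "admits_narrow_triangulation w m V E" "S \<subseteq> V"
  shows "admits_narrow_triangulation w m S (induced_edges E S)"
proof -
  obtain H where H: "E \<subseteq> H" "H \<subseteq> [V]\<^bsup>2\<^esup>" "chordal H"
    and K: "\<forall>K\<subseteq>V. is_clique H K \<longrightarrow> sum w K \<le> m"
    using assms by (auto simp: admits_narrow_triangulation_def triangulation_def)
  have "chordal (induced_edges H S)"
    using chordal_if_hereditarily_simplicial[OF hereditarily_simplicial_induced[OF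
          hereditarily_simplicial_if_chordal[OF H(3) card_edge[OF H(2)]]]] .
  moreover have "induced_edges E S \<subseteq> induced_edges H S" "induced_edges H S \<subseteq> H"
    using H by (auto simp: induced_edges_def)
  moreover have "induced_edges H S \<subseteq> [S]\<^bsup>2\<^esup>" using H(2) by (rule induced_edges_subset)
  ultimately show ?thesis
    unfolding admits_narrow_triangulation_def triangulation_def
    using K assms(2) by (meson is_clique_mono order_trans)
qed

text \<open>The invariant uses hereditary simpliciality and a bound on every clique because both
  survive gluing. In the small case every vertex set is already below the bound.\<close>

lemma W_Triangulate_correct:
  assumes "W_Triangulate w m \<alpha> V E W r"
    and "finite V" "E \<subseteq> [V]\<^bsup>2\<^esup>" "\<forall>v\<in>V. w v \<ge> 0" "\<alpha> \<ge> 1" "m > 0"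
    and "W \<subseteq> V" "sum w W < (\<alpha> + 1) * m"
  shows "case r of
      Added F \<Rightarrow> F \<subseteq> [V]\<^bsup>2\<^esup> \<and> hereditarily_simplicial (E \<union> F) \<and> is_clique (E \<union> F) W \<and>
        (\<forall>K\<subseteq>V. is_clique (E \<union> F) K \<longrightarrow> sum w K < (2 * \<alpha> + 1) * m)
    | Width_Exceeded \<Rightarrow> \<not> admits_narrow_triangulation w m V E"
  using assms
proof (induction rule: W_Triangulate.induct)
  case (small V E W F)
  have W: "[W]\<^bsup>2\<^esup> \<subseteq> [V]\<^bsup>2\<^esup>" using small.prems by (intro nsets_mono)
  then have F: "F \<subseteq> [V]\<^bsup>2\<^esup>" "hereditarily_simplicial (E \<union> [W]\<^bsup>2\<^esup> \<union> F)"
    using min_weight_fill_triangulates[OF small(2)] small.prems by auto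
  have "sum w K < (2 * \<alpha> + 1) * m" if "K \<subseteq> V" for K
  proof -
    have "sum w K \<le> sum w V" using that small.prems by (intro sum_mono2) auto
    then show ?thesis using small(1) by linarith
  qed
  then show ?case using W F by (auto simp: is_clique_def Un_assoc)
next
  case (not_found V E W)
  have "\<not> admits_narrow_triangulation w m V E"
  proof
    assume "admits_narrow_triangulation w m V E"
    then obtain H where H: "E \<subseteq> H" "H \<subseteq> [V]\<^bsup>2\<^esup>" "chordal H"
      "\<forall>K\<subseteq>V. is_clique H K \<longrightarrow> sum w K \<le> m"
      by (auto simp: admits_narrow_triangulation_def triangulation_def)
    then have "\<exists>X A B C. weighted_decomposition w m \<alpha> V E W X A B C"
      using not_found by (intro weighted_decomposition_exists[of V E H]) auto
    then show False using not_found by blast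
  qed
  then show ?case by simp
next
  case (split V E W X A B C rA rB rC)
  note d = \<open>weighted_decomposition w m \<alpha> V E W X A B C\<close>
  have dec: "X \<union> A \<union> B \<union> C = V" "X \<inter> A = {}" "X \<inter> B = {}" "X \<inter> C = {}"
      "A \<inter> B = {}" "A \<inter> C = {}" "B \<inter> C = {}"
    and none: "no_edges_between E A B" "no_edges_between E A C" "no_edges_between E B C"
    and wX: "sum w X \<le> \<alpha> * m"
    and wP: "sum w ((W \<inter> A) \<union> X) < (\<alpha> + 1) * m" "sum w ((W \<inter> B) \<union> X) < (\<alpha> + 1) * m"
      "sum w ((W \<inter> C) \<union> X) < (\<alpha> + 1) * m"
    using d unfolding weighted_decomposition_def decomposition_def by blast+
  have sub: "A \<union> X \<subseteq> V" "B \<union> X \<subseteq> V" "C \<union> X \<subseteq> V" using dec by auto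
  have fin: "finite (A \<union> X)" "finite (B \<union> X)" "finite (C \<union> X)"
    using sub split.prems(1) by (auto intro: finite_subset)
  let ?E = "\<lambda>P. induced_edges E (P \<union> X)"
  let ?ok = "\<lambda>P r. case r of
      Added F \<Rightarrow> F \<subseteq> [P \<union> X]\<^bsup>2\<^esup> \<and> hereditarily_simplicial (?E P \<union> F) \<and>
        is_clique (?E P \<union> F) ((W \<inter> P) \<union> X) \<and>
        (\<forall>K\<subseteq>P \<union> X. is_clique (?E P \<union> F) K \<longrightarrow> sum w K < (2 * \<alpha> + 1) * m)
    | Width_Exceeded \<Rightarrow> \<not> admits_narrow_triangulation w m (P \<union> X) (?E P)"
  have Esub: "?E P \<subseteq> [P \<union> X]\<^bsup>2\<^esup>" for P using split.prems(2) by (rule induced_edges_subset)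
  have IHA: "?ok A rA"
    by (rule split.IH(1)) (use fin Esub sub split.prems wP in auto)
  have IHB: "?ok B rB"
    by (rule split.IH(2)) (use fin Esub sub split.prems wP in auto)
  have IHC: "?ok C rC"
    by (rule split.IH(3)) (use fin Esub sub split.prems wP in auto)
  show ?case
  proof (cases "rA = Width_Exceeded \<or> rB = Width_Exceeded \<or> rC = Width_Exceeded")
    case True
    then have "combine ([W \<union> X]\<^bsup>2\<^esup>) rA rB rC = Width_Exceeded"
      by (cases rA; cases rB; cases rC) auto
    moreover have "\<not> admits_narrow_triangulation w m V E"
      using True IHA IHB IHC sub admits_narrow_triangulation_induced[of w m V E] by auto
    ultimately show ?thesis by simp
  next
    case False
    then obtain FA FB FC where r: "rA = Added FA" "rB = Added FB" "rC = Added FC"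
      by (cases rA; cases rB; cases rC) auto
    let ?light = "\<lambda>V H. H \<subseteq> [V]\<^bsup>2\<^esup> \<and> hereditarily_simplicial H \<and>
      (\<forall>K\<subseteq>V. is_clique H K \<longrightarrow> sum w K < (2 * \<alpha> + 1) * m)"
    have glue: "?light (V1 \<union> V2) (H1 \<union> H2)"
      if "?light V1 H1" "?light V2 H2" "is_clique H1 (V1 \<inter> V2)" "is_clique H2 (V1 \<inter> V2)"
      for V1 V2 H1 H2
    proof -
      have H: "H1 \<subseteq> [V1]\<^bsup>2\<^esup>" "hereditarily_simplicial H1" "H2 \<subseteq> [V2]\<^bsup>2\<^esup>" "hereditarily_simplicial H2"
        using that by simp_all
      note G = glue_along_clique[OF H(1,2) that(3) H(3,4) that(4)]
      have "sum w K < (2 * \<alpha> + 1) * m" if K: "K \<subseteq> V1 \<union> V2" "is_clique (H1 \<union> H2) K" for K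
        using G(2)[OF K] \<open>?light V1 H1\<close> \<open>?light V2 H2\<close> by blast
      moreover have "H1 \<union> H2 \<subseteq> [V1 \<union> V2]\<^bsup>2\<^esup>"
        using that nsets_mono[of V1 "V1 \<union> V2" 2] nsets_mono[of V2 "V1 \<union> V2" 2] by blast
      ultimately show ?thesis using G(1) by simp
    qed
    let ?H0 = "[W \<union> X]\<^bsup>2\<^esup>"
    let ?HA = "?E A \<union> FA" and ?HB = "?E B \<union> FB" and ?HC = "?E C \<union> FC"
    have WX: "W \<union> X \<subseteq> V" using split.prems dec by auto
    have "sum w (W \<union> X) \<le> sum w W + sum w X"
    proof -
      have "sum w (W \<inter> X) \<ge> 0" using split.prems by (intro sum_nonneg) auto
      moreover have "finite W" "finite X" using WX split.prems by (auto intro: finite_subset)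
      ultimately show ?thesis by (simp add: sum_Un)
    qed
    \<comment> \<open>The bounds \<open>(\<alpha> + 1) * m\<close> on \<open>W\<close> and
      \<open>\<alpha> * m\<close> on \<open>X\<close> add up to exactly this one.\<close>
    then have wWX: "sum w (W \<union> X) < (2 * \<alpha> + 1) * m"
      using wX split.prems by (simp add: algebra_simps)
    have "sum w K < (2 * \<alpha> + 1) * m" if "K \<subseteq> W \<union> X" for K
    proof -
      have "sum w K \<le> sum w (W \<union> X)"
        using that WX split.prems by (intro sum_mono2) (auto intro: finite_subset)
      then show ?thesis using wWX by linarith
    qed
    then have L0: "?light (W \<union> X) ?H0" by (simp add: hereditarily_simplicial_complete)
    have LA: "?light (A \<union> X) ?HA" "is_clique ?HA ((W \<inter> A) \<union> X)"
      and LB: "?light (B \<union> X) ?HB" "is_clique ?HB ((W \<inter> B) \<union> X)"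
      and LC: "?light (C \<union> X) ?HC" "is_clique ?HC ((W \<inter> C) \<union> X)"
      using IHA IHB IHC Esub by (auto simp: r)
    have c0: "is_clique H ((W \<inter> P) \<union> X)" if "?H0 \<subseteq> H" for H P
    proof -
      have "is_clique ?H0 (W \<union> X)" by (simp add: is_clique_def)
      then show ?thesis by (rule is_clique_mono[OF is_clique_subset _]) (use that in auto)
    qed
    \<comment> \<open>The three results are glued one after another onto the clique on
      \<open>W \<union> X\<close>. Since the parts are disjoint, what is built so far meets the next
      piece \<open>P \<union> X\<close> exactly in \<open>(W \<inter> P) \<union> X\<close>, a
      clique on both sides.\<close>
    have iA: "(W \<union> X) \<inter> (A \<union> X) = (W \<inter> A) \<union> X" by blast
    have L1: "?light (W \<union> X \<union> (A \<union> X)) (?H0 \<union> ?HA)"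
      by (rule glue[OF L0 LA(1), unfolded iA, OF c0 LA(2)]) simp
    have iB: "(W \<union> X \<union> (A \<union> X)) \<inter> (B \<union> X) = (W \<inter> B) \<union> X" using dec by blast
    have L2: "?light (W \<union> X \<union> (A \<union> X) \<union> (B \<union> X)) (?H0 \<union> ?HA \<union> ?HB)"
      by (rule glue[OF L1 LB(1), unfolded iB, OF c0 LB(2)]) blast
    have iC: "(W \<union> X \<union> (A \<union> X) \<union> (B \<union> X)) \<inter> (C \<union> X) = (W \<inter> C) \<union> X" using dec by blast
    have L3: "?light (W \<union> X \<union> (A \<union> X) \<union> (B \<union> X) \<union> (C \<union> X)) (?H0 \<union> ?HA \<union> ?HB \<union> ?HC)"
      by (rule glue[OF L2 LC(1), unfolded iC, OF c0 LC(2)]) blast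
    have Veq: "W \<union> X \<union> (A \<union> X) \<union> (B \<union> X) \<union> (C \<union> X) = V" using WX dec by blast
    \<comment> \<open>No edge joins different parts, so each edge lies within one piece
      \<open>P \<union> X\<close> and the glued graph contains all of \<open>E\<close>.\<close>
    have "E \<subseteq> ?E A \<union> ?E B \<union> ?E C"
    proof
      fix e assume e: "e \<in> E"
      then obtain x y where xy: "e = {x, y}" "x \<in> V" "y \<in> V"
        using split.prems(2) by (force simp: nsets_def card_2_iff)
      have "\<not> (x \<in> P \<and> y \<in> R) \<and> \<not> (y \<in> P \<and> x \<in> R)" if "no_edges_between E P R" for P R
        using that e xy(1) by (auto simp: no_edges_between_def insert_commute)
      from this[OF none(1)] this[OF none(2)] this[OF none(3)]
      show "e \<in> ?E A \<union> ?E B \<union> ?E C"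
        using e xy dec(1) by (auto simp: induced_edges_def)
    qed
    moreover have "?E P \<subseteq> E" for P by (auto simp: induced_edges_def)
    ultimately have eq: "?H0 \<union> ?HA \<union> ?HB \<union> ?HC = E \<union> (FA \<union> FB \<union> FC \<union> ?H0)" by blast
    have "?light V (E \<union> (FA \<union> FB \<union> FC \<union> ?H0))" using L3 unfolding Veq eq .
    moreover have "is_clique (E \<union> (FA \<union> FB \<union> FC \<union> ?H0)) W"
      by (rule is_clique_subset[OF c0[of _ W]]) auto
    ultimately show ?thesis by (simp add: r)
  qed
qed

section \<open>Clique weights, weighted cliquewidth and the final statement\<close>

lemma finite_clique_weights:
  assumes "finite V"
  shows "finite {sum w K | K. K \<subseteq> V \<and> is_clique H K}" "{sum w K | K. K \<subseteq> V \<and> is_clique H K} \<noteq> {}"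
proof -
  have "{sum w K | K. K \<subseteq> V \<and> is_clique H K} \<subseteq> sum w ` Pow V" by auto
  then show "finite {sum w K | K. K \<subseteq> V \<and> is_clique H K}" using assms by (meson finite_Pow_iff finite_surj)
  have "is_clique H {}" by (simp add: is_clique_iff)
  then show "{sum w K | K. K \<subseteq> V \<and> is_clique H K} \<noteq> {}" by blast
qed

text \<open>Every triangulation has a clique heavier than \<open>m\<close>, and the minimum is
  attained: there are finitely many triangulations, the complete graph among them.\<close>

lemma weighted_cliquewidth_greater:
  assumes "finite V" "E \<subseteq> [V]\<^bsup>2\<^esup>" "\<not> admits_narrow_triangulation w m V E"
  shows "weighted_cliquewidth w V E > m"
proof -
  let ?M = "{max_clique_weight w V H | H. triangulation V E H}"
  have "finite ([V]\<^bsup>2\<^esup>)" using assms(1) by (rule finite_imp_finite_nsets)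
  moreover have "?M \<subseteq> max_clique_weight w V ` Pow ([V]\<^bsup>2\<^esup>)" by (auto simp: triangulation_def)
  ultimately have "finite ?M" by (meson finite_Pow_iff finite_surj)
  moreover have "triangulation V E ([V]\<^bsup>2\<^esup>)"
    unfolding triangulation_def
    using assms(2) chordal_if_hereditarily_simplicial[OF hereditarily_simplicial_complete] by blast
  then have "?M \<noteq> {}" by blast
  moreover have "max_clique_weight w V H > m" if "triangulation V E H" for H
  proof -
    obtain K where K: "K \<subseteq> V" "is_clique H K" "sum w K > m"
      using assms(3) \<open>triangulation V E H\<close> unfolding admits_narrow_triangulation_def by (meson not_le)
    have "sum w K \<le> max_clique_weight w V H"
      unfolding max_clique_weight_def using finite_clique_weights(1)[OF assms(1)] K
      by (intro Max_ge) auto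
    then show ?thesis using K by linarith
  qed
  ultimately show ?thesis unfolding weighted_cliquewidth_def by (subst Min_gr_iff) auto
qed

theorem theorem4:
  fixes V :: "'a set" and E :: "'a set set" and W :: "'a set"
    and D :: "'a \<Rightarrow> 'b set" and w :: "'a \<Rightarrow> real" and m \<alpha> :: real
  assumes "finite V" and "E \<subseteq> [V]\<^bsup>2\<^esup>"
    and "\<And>v. v \<in> V \<Longrightarrow> finite (D v) \<and> card (D v) \<ge> 2"
    and "\<And>v. v \<in> V \<Longrightarrow> w v = log 2 (real (card (D v)))"
    and "\<alpha> \<ge> 1"
    and "W \<subseteq> V" and "sum w W < (\<alpha> + 1) * m"
  shows "Wellfounded.accp (recursive_call w m \<alpha>) (V, E, W) \<and>
    (\<exists>r. W_Triangulate w m \<alpha> V E W r) \<and>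
    (\<forall>r. W_Triangulate w m \<alpha> V E W r \<longrightarrow>
      (case r of
        Added F \<Rightarrow>
          triangulation V E (E \<union> F) \<and> is_clique (E \<union> F) W \<and>
          max_clique_weight w V (E \<union> F) < (2 * \<alpha> + 1) * m
      | Width_Exceeded \<Rightarrow> weighted_cliquewidth w V E > m))"
proof (intro conjI allI impI)
  show "Wellfounded.accp (recursive_call w m \<alpha>) (V, E, W)" using assms(1) by (rule recursive_call_accp)
  show "\<exists>r. W_Triangulate w m \<alpha> V E W r" using assms(1) by (rule W_Triangulate_exists)
  fix r assume r: "W_Triangulate w m \<alpha> V E W r"
  have w: "\<forall>v\<in>V. w v \<ge> 0"
    using assms(3,4) by fastforce
  \<comment> \<open>Positivity of \<open>m\<close> comes from the bound on \<open>W\<close>: a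
    non-negative weight is below \<open>(\<alpha> + 1) * m\<close>.\<close>
  have "0 \<le> sum w W" using w assms(6) by (intro sum_nonneg) auto
  then have "0 < (\<alpha> + 1) * m" using assms(7) by linarith
  then have m: "m > 0" using assms(5) by (simp add: zero_less_mult_iff)
  note correct = W_Triangulate_correct[OF r assms(1,2) w assms(5) m assms(6,7)]
  show "case r of
        Added F \<Rightarrow>
          triangulation V E (E \<union> F) \<and> is_clique (E \<union> F) W \<and>
          max_clique_weight w V (E \<union> F) < (2 * \<alpha> + 1) * m
      | Width_Exceeded \<Rightarrow> weighted_cliquewidth w V E > m"
  proof (cases r)
    case (Added F)
    have "max_clique_weight w V (E \<union> F) < (2 * \<alpha> + 1) * m"
      using correct finite_clique_weights[OF assms(1), of w "E \<union> F"]
      unfolding max_clique_weight_def by (subst Max_less_iff) (auto simp: Added)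
    then show ?thesis using correct assms(2)
      by (auto simp: Added triangulation_def chordal_if_hereditarily_simplicial)
  next
    case Width_Exceeded
    then show ?thesis using correct weighted_cliquewidth_greater[OF assms(1,2)] by simp
  qed
qed

end
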